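(* Let $A\in\mathbb{C}^{n\times n}$ satisfy $\Re(\lambda)>0$ for all $\lambda\in\sigma(A)$, and let $A=U(D+N)U^\ast$ be its Schur decomposition, with $U$ unitary, $D$ diagonal and $N$ strictly upper triangular. If $r\ge 1$, then $$\|\Gamma(A,r)\|_2\;\le\;\sum_{k=0}^{n-1}\frac{\|N-I\|_2^{\,k}}{k!}\,\Gamma\big(\alpha(A)+k,\,r\big).$$
   Context: $\sigma(A)$ is the spectrum of $A$, $I$ is the $n\times n$ identity matrix, and $\|\cdot\|_2$ is the matrix $2$-norm (spectral norm). The spectral abscissa is $\alpha(A):=\max\{\Re(\lambda):\lambda\in\sigma(A)\}$. For $t>0$ and a square matrix $M$, $t^{M}:=\exp(M\log t)$. For a matrix $A$ all of whose eigenvalues have positive real part and a real $r>0$, the complement of the incomplete gamma function is $\Gamma(A,r):=\int_r^\infty e^{-t}t^{A-I}\,dt$. For scalars, $\Gamma(x,r):=\int_r^\infty e^{-t}t^{x-1}\,dt$. *)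

theory Defs
  imports "HOL-Analysis.Analysis"
begin

definition spectrum :: "complex^'n^'n \<Rightarrow> complex set" where
  "spectrum A = {z. \<exists>v. v \<noteq> 0 \<and> A *v v = z *s v}"

definition spectral_abscissa :: "complex^'n^'n \<Rightarrow> real" where
  "spectral_abscissa A = Max (Re ` spectrum A)"

text \<open>The norm of \<open>complex^'n\<close> is the Euclidean one, so its operator norm is the
  spectral norm (the instance norm of \<open>complex^'n^'n\<close> is the Frobenius norm).\<close>

definition norm2 :: "complex^'n^'n \<Rightarrow> real" where
  "norm2 A = onorm (\<lambda>x. A *v x)"

definition adj :: "complex^'n^'n \<Rightarrow> complex^'n^'n" where
  "adj A = map_matrix cnj (transpose A)"

definition unitary :: "complex^'n^'n \<Rightarrow> bool" where
  "unitary U \<longleftrightarrow> adj U ** U = mat 1 \<and> U ** adj U = mat 1"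

definition diagonal :: "complex^'n^'n \<Rightarrow> bool" where
  "diagonal D \<longleftrightarrow> (\<forall>i j. i \<noteq> j \<longrightarrow> D $ i $ j = 0)"

text \<open>A finite well-ordered index type is \<open>1 < \<dots> < n\<close> up to renaming; the numeral
  types provide one for every positive size.\<close>

definition strictly_upper_triangular :: "complex^'n::{finite,wellorder}^'n::{finite,wellorder} \<Rightarrow> bool" where
  "strictly_upper_triangular N \<longleftrightarrow> (\<forall>i j. j \<le> i \<longrightarrow> N $ i $ j = 0)"

definition schur_decomposition ::
  "complex^'n::{finite,wellorder}^'n::{finite,wellorder} \<Rightarrow> complex^'n::{finite,wellorder}^'n::{finite,wellorder} \<Rightarrow> complex^'n::{finite,wellorder}^'n::{finite,wellorder} \<Rightarrow> complex^'n::{finite,wellorder}^'n::{finite,wellorder} \<Rightarrow> bool" where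
  "schur_decomposition A U D N \<longleftrightarrow>
     unitary U \<and> diagonal D \<and> strictly_upper_triangular N \<and> A = U ** (D + N) ** adj U"

text \<open>The class operations \<open>(*)\<close> and \<open>(^)\<close> act entrywise on \<open>complex^'n^'n\<close>, and
  the class constant \<open>exp\<close> is not available there.\<close>

primrec mat_pow :: "complex^'n^'n \<Rightarrow> nat \<Rightarrow> complex^'n^'n" where
  "mat_pow M 0 = mat 1"
| "mat_pow M (Suc k) = M ** mat_pow M k"

definition mat_exp :: "complex^'n^'n \<Rightarrow> complex^'n^'n" where
  "mat_exp M = (\<Sum>k. (1 / fact k) *\<^sub>R mat_pow M k)"

definition powr_mat :: "real \<Rightarrow> complex^'n^'n \<Rightarrow> complex^'n^'n" where
  "powr_mat t M = mat_exp (ln t *\<^sub>R M)"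

definition inc_Gamma :: "real \<Rightarrow> real \<Rightarrow> real" where
  "inc_Gamma x r = integral {r..} (\<lambda>t. exp (- t) * t powr (x - 1))"

definition mat_inc_Gamma :: "complex^'n^'n \<Rightarrow> real \<Rightarrow> complex^'n^'n" where
  "mat_inc_Gamma A r = integral {r..} (\<lambda>t. exp (- t) *\<^sub>R powr_mat t (A - mat 1))"

end

theory Submission
  imports Defs
begin

text \<open>On a diagonal matrix the exponential is controlled only through the real parts of the
  entries, whereas powers see their moduli. A scalar shift reconciles the two: since
  \<open>\<bar>d + c\<bar> - c\<close> tends to \<open>Re d\<close> as \<open>c \<rightarrow> \<infinity>\<close>, one expands \<open>(D + cI + N)\<^sup>m\<close> into words, those
  with at least \<open>n\<close> letters \<open>N\<close> being zero, sums the exponential series, multiplies by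
  \<open>e\<^sup>-\<^sup>c\<close> and lets \<open>c \<rightarrow> \<infinity>\<close>. This bounds \<open>t\<close> to the power \<open>A - I\<close> by
  \<open>t\<close> to the power \<open>\<alpha>(A) - 1\<close> times the sum of \<open>(\<parallel>N\<parallel> log t)\<^sup>k / k!\<close> over \<open>k < n\<close>. Although
  \<open>\<parallel>N\<parallel> \<le> \<parallel>N - I\<parallel>\<close> may fail, \<open>\<parallel>N - I\<parallel> \<ge> 1\<close> because of its diagonal entries, so
  \<open>\<parallel>N\<parallel> log t \<le> (\<parallel>N - I\<parallel> + 1) t / 2 \<le> \<parallel>N - I\<parallel> t\<close>. Integration over \<open>t \<ge> r\<close> gives the claim.\<close>

section \<open>The spectral norm\<close>

lemmas scaleR_complex = scaleR_conv_of_real[where 'a = complex]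

lemma matrix_add_rdistrib: "(A + B) ** C = A ** C + B ** (C :: complex^'n^'n)"
  by (simp add: matrix_matrix_mult_def vec_eq_iff distrib_right sum.distrib)

lemma matrix_diff_ldistrib: "A ** (B - C) = A ** B - A ** (C :: complex^'n^'n)"
  by (simp add: matrix_matrix_mult_def vec_eq_iff right_diff_distrib sum_subtractf)

lemma matrix_diff_rdistrib: "(A - B) ** C = A ** C - B ** (C :: complex^'n^'n)"
  by (simp add: matrix_matrix_mult_def vec_eq_iff left_diff_distrib sum_subtractf)

lemma norm2_nonneg: "0 \<le> norm2 M"
  unfolding norm2_def by (rule onorm_pos_le) simp

lemma norm_mult_vec_le: "norm (M *v v) \<le> norm2 M * norm v"
  unfolding norm2_def by (rule onorm) simp

lemma norm2_leI: "(\<And>v. norm (M *v v) \<le> b * norm v) \<Longrightarrow> norm2 M \<le> b"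
  unfolding norm2_def by (rule onorm_le)

lemma norm2_zero [simp]: "norm2 0 = 0"
  by (rule antisym[OF norm2_leI norm2_nonneg]) simp

lemma norm2_mat_1_le: "norm2 (mat 1 :: complex^'a^'a) \<le> 1"
  by (rule norm2_leI) simp

lemma norm2_mult: "norm2 (A ** B) \<le> norm2 A * norm2 B"
proof (rule norm2_leI)
  fix v
  have "norm (A ** B *v v) \<le> norm2 A * norm (B *v v)"
    by (metis matrix_vector_mul_assoc norm_mult_vec_le)
  also have "\<dots> \<le> norm2 A * (norm2 B * norm v)"
    by (intro mult_left_mono norm_mult_vec_le norm2_nonneg)
  finally show "norm (A ** B *v v) \<le> norm2 A * norm2 B * norm v"
    by (simp add: mult.assoc)
qed

lemma norm2_add: "norm2 (A + B) \<le> norm2 A + norm2 B"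
proof (rule norm2_leI)
  fix v
  have "norm ((A + B) *v v) \<le> norm (A *v v) + norm (B *v v)"
    by (simp add: matrix_vector_mult_add_rdistrib norm_triangle_ineq)
  also have "\<dots> \<le> norm2 A * norm v + norm2 B * norm v"
    by (intro add_mono norm_mult_vec_le)
  finally show "norm ((A + B) *v v) \<le> (norm2 A + norm2 B) * norm v"
    by (simp add: distrib_right)
qed

lemma norm2_sum: "norm2 (\<Sum>k\<in>S. f k) \<le> (\<Sum>k\<in>S. norm2 (f k))"
proof (induction S rule: infinite_finite_induct)
  case (insert x F)
  then show ?case
    using norm2_add[of "f x" "sum f F"] by simp
qed simp_all

lemma scaleR_mult_vec: "(c *\<^sub>R M) *v v = c *\<^sub>R (M *v (v :: complex^'n))"
  by (simp add: vec_eq_iff matrix_vector_mult_def scaleR_sum_right)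

lemma bounded_linear_mult_vec: "bounded_linear (\<lambda>X :: complex^'n^'n. X *v v)"
  unfolding linear_conv_bounded_linear[symmetric]
  by (rule linearI) (simp_all add: matrix_vector_mult_add_rdistrib scaleR_mult_vec)

lemma norm2_scaleR: "norm2 (c *\<^sub>R M) = \<bar>c\<bar> * norm2 M"
  unfolding norm2_def scaleR_mult_vec by (rule onorm_scaleR) simp

lemma norm2_diagonal_le:
  fixes P :: "complex^'n^'n"
  assumes "diagonal P" and "\<And>i. cmod (P $ i $ i) \<le> \<rho>"
  shows "norm2 P \<le> \<rho>"
proof (rule norm2_leI)
  fix v :: "complex^'n"
  have \<rho>: "0 \<le> \<rho>"
    using assms(2) norm_ge_zero order_trans by blast
  have *: "(P *v v) $ i = P $ i $ i * v $ i" for i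
  proof -
    have "(P *v v) $ i = (\<Sum>j\<in>UNIV. if j = i then P $ i $ i * v $ i else 0)"
      unfolding matrix_vector_mult_def vec_lambda_beta
      using assms(1) by (intro sum.cong) (auto simp: diagonal_def)
    then show ?thesis by simp
  qed
  have "norm (P *v v) \<le> norm (\<rho> *\<^sub>R v)"
    by (rule norm_le_componentwise_cart)
       (use \<rho> assms(2) in \<open>simp add: * norm_mult mult_right_mono\<close>)
  then show "norm (P *v v) \<le> \<rho> * norm v"
    using \<rho> by simp
qed

text \<open>An entry is a coordinate of the image of a unit vector. This dominates the exponential
  series entrywise and later bounds \<open>norm2 (N - mat 1)\<close> from below.\<close>

lemma norm_entry_le_norm2: "cmod (M $ i $ j) \<le> norm2 M"
proof -
  have "cmod (M $ i $ j) = norm ((M *v axis j 1) $ i)"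
    by (simp add: matrix_vector_mult_def axis_def if_distrib cong: if_cong)
  also have "\<dots> \<le> norm (M *v axis j 1)"
    by (rule Finite_Cartesian_Product.norm_nth_le)
  also have "\<dots> \<le> norm2 M"
    using norm_mult_vec_le[of M "axis j 1"] by simp
  finally show ?thesis .
qed

text \<open>Moving \<open>U\<close> across the Hermitian inner product turns <Uv, Uv> into <v, U*Uv>
  = <v, v>. Assuming just this one identity lets the lemma serve \<open>adj U\<close> as
  well.\<close>

lemma norm_unitary_mult_vec:
  assumes "adj U ** U = mat 1"
  shows "norm (U *v v) = norm v"
proof -
  have sq: "complex_of_real ((norm w)\<^sup>2) = (\<Sum>i\<in>UNIV. cnj (w $ i) * w $ i)" for w :: "complex^'n"
    by (simp add: norm_vec_def L2_set_def sum_nonneg complex_norm_square mult.commute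
        del: of_real_power)
  have "(\<Sum>i\<in>UNIV. cnj ((U *v v) $ i) * (U *v v) $ i)
      = (\<Sum>i\<in>UNIV. \<Sum>j\<in>UNIV. cnj (v $ j) * (adj U $ j $ i * (U *v v) $ i))"
  proof (intro sum.cong refl)
    fix i
    have "cnj ((U *v v) $ i) = (\<Sum>j\<in>UNIV. cnj (v $ j) * adj U $ j $ i)"
      by (simp add: matrix_vector_mult_def adj_def transpose_def mult.commute)
    then show "cnj ((U *v v) $ i) * (U *v v) $ i
        = (\<Sum>j\<in>UNIV. cnj (v $ j) * (adj U $ j $ i * (U *v v) $ i))"
      by (simp only: sum_distrib_right mult.assoc)
  qed
  also have "\<dots> = (\<Sum>j\<in>UNIV. cnj (v $ j) * (adj U *v (U *v v)) $ j)"
    by (subst sum.swap) (simp add: matrix_vector_mult_def[of "adj U"] sum_distrib_left)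
  also have "\<dots> = (\<Sum>j\<in>UNIV. cnj (v $ j) * v $ j)"
    by (simp add: matrix_vector_mul_assoc assms)
  finally have "(norm (U *v v))\<^sup>2 = (norm v)\<^sup>2"
    unfolding sq[symmetric] of_real_eq_iff .
  then show ?thesis by simp
qed

lemma adj_adj: "adj (adj U) = U"
  by (simp add: adj_def transpose_def vec_eq_iff)

lemma norm2_unitary_conj_le:
  assumes "unitary U"
  shows "norm2 (U ** M ** adj U) \<le> norm2 M"
proof (rule norm2_leI)
  fix v
  have "norm (U ** M ** adj U *v v) = norm (U *v (M *v (adj U *v v)))"
    by (simp add: matrix_vector_mul_assoc matrix_mul_assoc)
  also have "\<dots> = norm (M *v (adj U *v v))"
    using assms by (simp add: unitary_def norm_unitary_mult_vec)
  also have "\<dots> \<le> norm2 M * norm (adj U *v v)"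
    by (rule norm_mult_vec_le)
  also have "norm (adj U *v v) = norm v"
    using assms by (simp add: unitary_def adj_adj norm_unitary_mult_vec)
  finally show "norm (U ** M ** adj U *v v) \<le> norm2 M * norm v" .
qed

section \<open>The noncommutative binomial expansion\<close>

text \<open>The sum of all words of length \<open>m\<close> in \<open>P\<close> and \<open>Q\<close> with exactly \<open>k\<close> letters \<open>Q\<close>.\<close>

fun word_sum :: "complex^'n^'n \<Rightarrow> complex^'n^'n \<Rightarrow> nat \<Rightarrow> nat \<Rightarrow> complex^'n^'n" where
  "word_sum P Q 0 0 = mat 1"
| "word_sum P Q 0 (Suc k) = 0"
| "word_sum P Q (Suc m) 0 = P ** word_sum P Q m 0"
| "word_sum P Q (Suc m) (Suc k) = P ** word_sum P Q m (Suc k) + Q ** word_sum P Q m k"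

lemma word_sum_eq_0: "m < k \<Longrightarrow> word_sum P Q m k = 0"
  by (induction P Q m k rule: word_sum.induct) auto

lemma matrix_sum_ldistrib: "(A :: complex^'n^'n) ** (\<Sum>k\<in>S. f k) = (\<Sum>k\<in>S. A ** f k)"
  by (induction S rule: infinite_finite_induct) (auto simp: matrix_add_ldistrib)

text \<open>Words with more letters \<open>Q\<close> than their length vanish, so any cutoff beyond
  \<open>m\<close> will do. The induction uses this freedom: the two products need cutoffs that
  differ by one.\<close>

lemma mat_pow_add: "m < K \<Longrightarrow> mat_pow (P + Q) m = (\<Sum>k<K. word_sum P Q m k)"
proof (induction m arbitrary: K)
  case 0
  then obtain K' where K: "K = Suc K'" by (cases K) auto
  show ?case
    by (simp add: K sum.lessThan_Suc_shift del: sum.lessThan_Suc)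
next
  case (Suc m)
  then obtain K' where K: "K = Suc K'" and K': "m < K'" by (cases K) auto
  have "mat_pow (P + Q) (Suc m) = P ** mat_pow (P + Q) m + Q ** mat_pow (P + Q) m"
    by (simp add: matrix_add_rdistrib)
  also have "P ** mat_pow (P + Q) m = (\<Sum>k<Suc K'. P ** word_sum P Q m k)"
    using K' Suc.IH[of "Suc K'"] by (simp only: matrix_sum_ldistrib less_SucI)
  also have "Q ** mat_pow (P + Q) m = (\<Sum>k<K'. Q ** word_sum P Q m k)"
    using Suc.IH[of K'] K' by (simp add: matrix_sum_ldistrib)
  finally show ?case
    by (simp add: K sum.lessThan_Suc_shift sum.distrib algebra_simps del: sum.lessThan_Suc)
qed

text \<open>There are \<open>m choose k\<close> words, and submultiplicativity bounds each by
  \<open>\<rho> ^ (m - k) * \<nu> ^ k\<close>. The recursion of \<open>word_sum\<close> mirrors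
  Pascal's rule.\<close>

lemma norm2_word_sum_le:
  assumes "norm2 P \<le> \<rho>" and "norm2 Q \<le> \<nu>"
  shows "norm2 (word_sum P Q m k) \<le> real (m choose k) * \<rho> ^ (m - k) * \<nu> ^ k"
proof -
  have \<rho>: "0 \<le> \<rho>" and \<nu>: "0 \<le> \<nu>"
    using assms norm2_nonneg order_trans by blast+
  show ?thesis
    using assms
  proof (induction P Q m k rule: word_sum.induct)
    case (1 P Q)
    then show ?case by (simp add: norm2_mat_1_le)
  next
    case (3 P Q m)
    have "norm2 (P ** word_sum P Q m 0) \<le> norm2 P * norm2 (word_sum P Q m 0)"
      by (rule norm2_mult)
    also have "\<dots> \<le> \<rho> * \<rho> ^ m"
      using 3 by (intro mult_mono) (auto simp: \<rho> norm2_nonneg)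
    finally show ?case by simp
  next
    case (4 P Q m k)
    have "norm2 (P ** word_sum P Q m (Suc k) + Q ** word_sum P Q m k)
      \<le> norm2 P * norm2 (word_sum P Q m (Suc k)) + norm2 Q * norm2 (word_sum P Q m k)"
      by (intro order_trans[OF norm2_add] add_mono norm2_mult)
    also have "\<dots> \<le> \<rho> * (real (m choose Suc k) * \<rho> ^ (m - Suc k) * \<nu> ^ Suc k)
        + \<nu> * (real (m choose k) * \<rho> ^ (m - k) * \<nu> ^ k)"
      using 4 by (intro add_mono mult_mono) (auto simp: \<rho> \<nu> norm2_nonneg)
    also have "\<rho> * (real (m choose Suc k) * \<rho> ^ (m - Suc k) * \<nu> ^ Suc k)
        = real (m choose Suc k) * \<rho> ^ (m - k) * \<nu> ^ Suc k"
    \<comment> \<open>For \<open>m \<le> k\<close> the natural subtraction truncates, but then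
      \<open>m choose Suc k\<close> is 0 and both sides vanish.\<close>
    proof (cases "k < m")
      case True
      then have "\<rho> ^ (m - k) = \<rho> * \<rho> ^ (m - Suc k)"
        by (metis Suc_diff_Suc power_Suc)
      then show ?thesis by simp
    qed simp
    finally show ?case
      by (simp add: algebra_simps)
  qed simp
qed

text \<open>A scalar matrix commutes with \<open>M\<close>, so all words with the same letter counts
  coincide and the expansion becomes the ordinary binomial theorem.\<close>

lemma word_sum_scalar:
  fixes M :: "complex^'n^'n"
  shows "word_sum (c *\<^sub>R mat 1) M m k = (real (m choose k) * c ^ (m - k)) *\<^sub>R mat_pow M k"
proof (induction "c *\<^sub>R mat 1 :: complex^'n^'n" M m k rule: word_sum.induct)
  case (4 M m k)
  have eq: "c * (real (m choose Suc k) * c ^ (m - Suc k)) = real (m choose Suc k) * c ^ (m - k)"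
  proof (cases "k < m")
    case True
    then have "c ^ (m - k) = c * c ^ (m - Suc k)"
      by (metis Suc_diff_Suc power_Suc)
    then show ?thesis by simp
  qed simp
  have "real (Suc m choose Suc k) * c ^ (Suc m - Suc k)
      = c * (real (m choose Suc k) * c ^ (m - Suc k)) + real (m choose k) * c ^ (m - k)"
    unfolding eq by (simp add: distrib_right)
  then show ?case
    using 4 by (simp only: word_sum.simps mat_pow.simps scalar_matrix_assoc[symmetric]
        matrix_scalar_ac matrix_mul_lid scaleR_scaleR scaleR_left_distrib mult_ac)
qed (simp_all add: scalar_matrix_assoc[symmetric])

lemma mat_pow_add_scalar:
  "mat_pow (c *\<^sub>R mat 1 + M) m = (\<Sum>k\<le>m. (real (m choose k) * c ^ (m - k)) *\<^sub>R mat_pow M k)"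
  using mat_pow_add[of m "Suc m" "c *\<^sub>R mat 1" M]
  by (simp add: word_sum_scalar lessThan_Suc_atMost)

text \<open>A nonzero entry of a word with \<open>k\<close> letters \<open>Q\<close> lies on or above the \<open>k\<close>-th superdiagonal;
  \<open>card {..<i}\<close> is the position of the index \<open>i\<close>.\<close>

lemma word_sum_entry_eq_0:
  fixes P Q :: "complex^'n::{finite,wellorder}^'n::{finite,wellorder}"
  assumes "diagonal P" "strictly_upper_triangular Q" "card {..<j} < card {..<i} + k"
  shows "word_sum P Q m k $ i $ j = 0"
  using assms
proof (induction P Q m k arbitrary: i rule: word_sum.induct)
  case (1 P Q)
  then show ?case by (auto simp: mat_def)
next
  case (3 P Q m)
  have "P $ i $ l * word_sum P Q m 0 $ l $ j = 0" for l
    using 3 by (cases "l = i") (auto simp: diagonal_def)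
  then show ?case by (auto simp: matrix_matrix_mult_def intro!: sum.neutral)
next
  case (4 P Q m k)
  have "P $ i $ l * word_sum P Q m (Suc k) $ l $ j = 0" for l
    using 4 by (cases "l = i") (auto simp: diagonal_def)
  moreover have "Q $ i $ l * word_sum P Q m k $ l $ j = 0" for l
  proof (cases "l \<le> i")
    case True
    then show ?thesis using 4 by (simp add: strictly_upper_triangular_def)
  next
    case False
    \<comment> \<open>Beyond the diagonal the position rises by at least one, which makes up for the
      letter \<open>Q\<close> split off.\<close>
    then have "card {..<i} < card {..<l}"
      by (intro psubset_card_mono) auto
    then show ?thesis using 4 by simp
  qed
  ultimately have "(\<Sum>l\<in>UNIV. P $ i $ l * word_sum P Q m (Suc k) $ l $ j) = 0"
      and "(\<Sum>l\<in>UNIV. Q $ i $ l * word_sum P Q m k $ l $ j) = 0"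
    by (auto intro!: sum.neutral)
  then show ?case by (simp add: matrix_matrix_mult_def)
qed simp

text \<open>Positions range over 0, ..., n - 1, so no entry lies on or above the n-th
  superdiagonal.\<close>

lemma word_sum_nilpotent:
  fixes P Q :: "complex^'n::{finite,wellorder}^'n::{finite,wellorder}"
  assumes "diagonal P" "strictly_upper_triangular Q" "CARD('n) \<le> k"
  shows "word_sum P Q m k = 0"
proof -
  have "card {..<j} < CARD('n)" for j :: 'n
    by (intro psubset_card_mono) auto
  then have "card {..<j} < card {..<i} + k" for i j :: 'n
    using assms(3) by (meson order_less_le_trans trans_le_add2)
  then show ?thesis
    using word_sum_entry_eq_0[OF assms(1,2)] by (simp add: vec_eq_iff)
qed

lemma norm2_mat_pow_triangular_le:
  fixes P Q :: "complex^'n::{finite,wellorder}^'n::{finite,wellorder}"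
  assumes "diagonal P" "strictly_upper_triangular Q" "norm2 P \<le> \<rho>"
  shows "norm2 (mat_pow (P + Q) m)
    \<le> (\<Sum>k<CARD('n). real (m choose k) * \<rho> ^ (m - k) * norm2 Q ^ k)"
proof -
  \<comment> \<open>The cutoff exceeds \<open>m\<close>, as the expansion requires, and is at least
    \<open>CARD('n)\<close>, so that shortening the sum drops only zero terms.\<close>
  have "mat_pow (P + Q) m = (\<Sum>k<CARD('n) + Suc m. word_sum P Q m k)"
    by (rule mat_pow_add) simp
  also have "\<dots> = (\<Sum>k<CARD('n). word_sum P Q m k)"
    using assms(1,2) by (intro sum.mono_neutral_right) (auto intro: word_sum_nilpotent)
  also have "norm2 \<dots> \<le> (\<Sum>k<CARD('n). real (m choose k) * \<rho> ^ (m - k) * norm2 Q ^ k)"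
    by (intro order_trans[OF norm2_sum] sum_mono norm2_word_sum_le assms(3) order_refl)
  finally show ?thesis .
qed

section \<open>The matrix exponential\<close>

lemma norm2_mat_pow_le: "norm2 (mat_pow M k) \<le> norm2 M ^ k"
proof (induction k)
  case 0
  then show ?case by (simp add: norm2_mat_1_le)
next
  case (Suc k)
  then show ?case
    using norm2_mult[of M "mat_pow M k"] norm2_nonneg[of M]
    by (simp) (meson mult_left_mono order_trans)
qed

text \<open>Absolute summability is stated because the Cauchy product in
  \<open>mat_exp_add_scalar\<close> requires it.\<close>

lemma summable_mat_pow_entry: "summable (\<lambda>k. cmod (mat_pow M k $ i $ j / fact k))"
proof (rule summable_comparison_test')
  show "summable (\<lambda>k. norm2 M ^ k /\<^sub>R fact k)"
    by (rule summable_exp_generic)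
  show "norm (cmod (mat_pow M k $ i $ j / fact k)) \<le> norm2 M ^ k /\<^sub>R fact k" if "k \<ge> 0" for k
    using order_trans[OF norm_entry_le_norm2 norm2_mat_pow_le, of M k i j]
    by (simp add: norm_divide divide_simps)
qed

lemma sums_matI: "(\<And>i j. (\<lambda>k. f k $ i $ j) sums (L $ i $ j)) \<Longrightarrow> f sums (L :: complex^'n^'n)"
  unfolding sums_def by (intro vec_tendstoI) simp

text \<open>An infinite sum has a meaningful value only once convergence is known; here it follows
  from convergence of the finitely many entries.\<close>

lemma mat_exp_sums: "(\<lambda>k. (1 / fact k) *\<^sub>R mat_pow M k) sums mat_exp M"
proof -
  have "(\<lambda>k. (1 / fact k) *\<^sub>R mat_pow M k) sums (\<chi> i j. \<Sum>k. mat_pow M k $ i $ j / fact k)"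
  proof (rule sums_matI)
    fix i j
    have "(\<lambda>k. mat_pow M k $ i $ j / fact k) sums (\<Sum>k. mat_pow M k $ i $ j / fact k)"
      by (intro summable_sums summable_norm_cancel[OF summable_mat_pow_entry])
    moreover have "((1 / fact k) *\<^sub>R mat_pow M k) $ i $ j = mat_pow M k $ i $ j / fact k" for k
      by (simp add: scaleR_complex)
    ultimately show "(\<lambda>k. ((1 / fact k) *\<^sub>R mat_pow M k) $ i $ j)
        sums ((\<chi> i j. \<Sum>k. mat_pow M k $ i $ j / fact k) $ i $ j)"
      by simp
  qed
  then show ?thesis
    unfolding mat_exp_def by (rule summable_sums[OF sums_summable])
qed

lemma mat_exp_entry_sums:
  fixes M :: "complex^'n^'n"
  shows "(\<lambda>k. mat_pow M k $ i $ j / fact k) sums (mat_exp M $ i $ j)"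
proof -
  have "bounded_linear (\<lambda>X :: complex^'n^'n. X $ i $ j)"
    by (intro bounded_linear_compose[OF bounded_linear_vec_nth] bounded_linear_vec_nth)
  from bounded_linear.sums[OF this mat_exp_sums[of M]]
  show ?thesis by (simp add: scaleR_complex)
qed

text \<open>Each entry of the left side is the Cauchy product of the entry series of
  \<open>mat_exp M\<close> with the scalar exponential series, since (m choose k) / m! = 1 / (k! (m
  - k)!).\<close>

lemma mat_exp_add_scalar: "mat_exp (c *\<^sub>R mat 1 + M) = exp c *\<^sub>R mat_exp M"
proof -
  have "mat_exp (c *\<^sub>R mat 1 + M) $ i $ j = complex_of_real (exp c) * mat_exp M $ i $ j" for i j
  proof (rule sums_unique2)
    show "(\<lambda>m. mat_pow (c *\<^sub>R mat 1 + M) m $ i $ j / fact m)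
        sums (mat_exp (c *\<^sub>R mat 1 + M) $ i $ j)"
      by (rule mat_exp_entry_sums)
    have exp: "(\<lambda>k. of_real c ^ k / fact k) sums (exp (of_real c) :: complex)"
      using exp_converges[of "of_real c :: complex"] by (simp add: scaleR_complex divide_inverse mult.commute)
    have "summable (\<lambda>k. cmod (of_real c ^ k / fact k))"
      using summable_norm_exp[of "of_real c :: complex"] 
      by (simp add: norm_divide norm_mult norm_inverse divide_inverse mult.commute)
    from Cauchy_product_sums[OF summable_mat_pow_entry[of M i j] this]
    have "(\<lambda>m. \<Sum>k\<le>m. mat_pow M k $ i $ j / fact k * (of_real c ^ (m - k) / fact (m - k)))
        sums (mat_exp M $ i $ j * exp (of_real c))"
      using sums_unique[OF exp] sums_unique[OF mat_exp_entry_sums[of M i j]] by simp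
    moreover have "(\<Sum>k\<le>m. mat_pow M k $ i $ j / fact k * (of_real c ^ (m - k) / fact (m - k)))
        = mat_pow (c *\<^sub>R mat 1 + M) m $ i $ j / fact m" for m
      unfolding mat_pow_add_scalar sum_component sum_divide_distrib
    proof (intro sum.cong refl)
      fix k assume "k \<in> {..m}"
      then have "(of_nat (m choose k) :: complex) = fact m / (fact k * fact (m - k))"
        by (intro binomial_fact) simp
      then show "mat_pow M k $ i $ j / fact k * (of_real c ^ (m - k) / fact (m - k))
          = ((real (m choose k) * c ^ (m - k)) *\<^sub>R mat_pow M k) $ i $ j / fact m"
        by (simp add: scaleR_complex)
    qed
    ultimately show "(\<lambda>m. mat_pow (c *\<^sub>R mat 1 + M) m $ i $ j / fact m)
        sums (complex_of_real (exp c) * mat_exp M $ i $ j)"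
      by (simp add: mult.commute exp_of_real)
  qed
  then show ?thesis
    by (simp add: vec_eq_iff) (simp add: scaleR_complex)
qed

lemma norm2_mat_exp_le:
  fixes M :: "complex^'n^'n"
  assumes "\<And>m. norm2 (mat_pow M m) \<le> b m" and "(\<lambda>m. b m / fact m) sums S"
  shows "norm2 (mat_exp M) \<le> S"
proof (rule norm2_leI)
  fix v
  \<comment> \<open>Applying the series to a vector moves the estimate to a space whose instance
    norm is the Euclidean one; \<open>norm2\<close> is not the instance norm of matrices.\<close>
  have "(\<lambda>m. ((1 / fact m) *\<^sub>R mat_pow M m) *v v) sums (mat_exp M *v v)"
    by (rule bounded_linear.sums[OF bounded_linear_mult_vec mat_exp_sums])
  moreover have "(\<lambda>m. b m / fact m * norm v) sums (S * norm v)"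
    by (rule sums_mult2[OF assms(2)])
  moreover have "norm (((1 / fact m) *\<^sub>R mat_pow M m) *v v) \<le> b m / fact m * norm v" for m
  proof -
    have "norm (((1 / fact m) *\<^sub>R mat_pow M m) *v v) \<le> norm2 (mat_pow M m) * norm v / fact m"
      by (simp add: scaleR_mult_vec norm_mult_vec_le divide_right_mono)
    also have "\<dots> \<le> b m * norm v / fact m"
      by (intro divide_right_mono mult_right_mono assms(1)) auto
    finally show ?thesis by simp
  qed
  ultimately show "norm (mat_exp M *v v) \<le> S * norm v"
    by (rule norm_sums_le)
qed

lemma mat_pow_unitary_conj:
  assumes "unitary U"
  shows "mat_pow (U ** M ** adj U) k = U ** mat_pow M k ** adj U"
proof (induction k)
  case 0
  then show ?case using assms by (simp add: unitary_def)
next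
  case (Suc k)
  have "mat_pow (U ** M ** adj U) (Suc k) = U ** M ** (adj U ** U) ** mat_pow M k ** adj U"
    by (simp add: Suc matrix_mul_assoc)
  also have "adj U ** U = mat 1" using assms by (simp add: unitary_def)
  finally show ?case by (simp add: matrix_mul_assoc)
qed

lemma mat_exp_unitary_conj:
  fixes M :: "complex^'n^'n"
  assumes "unitary U"
  shows "mat_exp (U ** M ** adj U) = U ** mat_exp M ** adj U"
proof (rule sums_unique2[OF mat_exp_sums])
  have "bounded_linear (\<lambda>X :: complex^'n^'n. U ** X ** adj U)"
    unfolding linear_conv_bounded_linear[symmetric]
    by (rule linearI)
       (simp_all add: matrix_add_ldistrib matrix_add_rdistrib matrix_scalar_ac scalar_matrix_assoc)
  from bounded_linear.sums[OF this mat_exp_sums[of M]]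
  show "(\<lambda>k. (1 / fact k) *\<^sub>R mat_pow (U ** M ** adj U) k) sums (U ** mat_exp M ** adj U)"
    by (simp add: mat_pow_unitary_conj[OF assms] matrix_scalar_ac scalar_matrix_assoc)
qed

text \<open>The terms with \<open>m < k\<close> are zero; after shifting by \<open>k\<close>, the
  coefficient (m + k choose k) / (m + k)! splits as 1 / (m! k!), leaving the series of
  \<open>exp \<rho>\<close>.\<close>

lemma binomial_exp_sums:
  fixes \<rho> :: real
  shows "(\<lambda>m. real (m choose k) * \<rho> ^ (m - k) / fact m) sums (exp \<rho> / fact k)"
proof -
  have "(\<lambda>m. \<rho> ^ m / fact m / fact k) sums (exp \<rho> / fact k)"
    using exp_converges[of \<rho>] by (intro sums_divide) (simp add: divide_inverse mult.commute)
  moreover have "\<rho> ^ m / fact m / fact k = real (m + k choose k) * \<rho> ^ (m + k - k) / fact (m + k)" for m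
    by (subst binomial_fact) auto
  ultimately have "(\<lambda>m. real (m + k choose k) * \<rho> ^ (m + k - k) / fact (m + k)) sums (exp \<rho> / fact k)"
    by simp
  then show ?thesis
    by (subst sums_zero_iff_shift[symmetric, of k]) auto
qed

lemma cmod_add_real_le:
  assumes "Re p \<le> a" "0 < \<epsilon>"
  shows "\<forall>\<^sub>F c in at_top. cmod (p + of_real c) \<le> a + \<epsilon> + c"
  \<comment> \<open>The first bound makes \<open>Re p + c\<close> nonnegative. The second makes the
    cross term \<open>2 * \<epsilon> * (Re p + c)\<close> of
    \<open>(Re p + c + \<epsilon>)\<^sup>2\<close> absorb \<open>(Im p)\<^sup>2\<close>.\<close>
  using eventually_ge_at_top[of "max (- Re p) ((Im p)\<^sup>2 / (2 * \<epsilon>) - Re p)"]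
proof eventually_elim
  case (elim c)
  then have c: "0 \<le> Re p + c" and "(Im p)\<^sup>2 / (2 * \<epsilon>) \<le> Re p + c" by auto
  then have "(Im p)\<^sup>2 \<le> 2 * \<epsilon> * (Re p + c)"
    using assms(2) by (simp add: pos_divide_le_eq mult.commute)
  then have "(Re p + c)\<^sup>2 + (Im p)\<^sup>2 \<le> (Re p + c + \<epsilon>)\<^sup>2"
    by (simp add: power2_eq_square algebra_simps) (use zero_le_square[of \<epsilon>] in linarith)
  then have "cmod (p + of_real c) \<le> Re p + c + \<epsilon>"
    using c assms(2) by (simp add: cmod_def real_le_lsqrt)
  then show ?case using assms(1) by simp
qed

text \<open>The limit in the shift is taken indirectly: for each \<open>\<epsilon>\<close> one
  finite \<open>c\<close> gives the bound with \<open>a + \<epsilon>\<close>, and then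
  \<open>\<epsilon>\<close> tends to 0 from the right.\<close>

lemma norm2_mat_exp_triangular_le:
  fixes P Q :: "complex^'n::{finite,wellorder}^'n::{finite,wellorder}"
  assumes P: "diagonal P" and Q: "strictly_upper_triangular Q" and a: "\<And>i. Re (P $ i $ i) \<le> a"
  shows "norm2 (mat_exp (P + Q)) \<le> exp a * (\<Sum>k<CARD('n). norm2 Q ^ k / fact k)"
proof -
  define S where "S = (\<Sum>k<CARD('n). norm2 Q ^ k / fact k)"
  have "norm2 (mat_exp (P + Q)) \<le> exp (a + \<epsilon>) * S" if "0 < \<epsilon>" for \<epsilon>
  proof -
    have "\<forall>\<^sub>F c in at_top. \<forall>i\<in>UNIV. cmod (P $ i $ i + of_real c) \<le> a + \<epsilon> + c"
      using a that by (intro eventually_ball_finite ballI cmod_add_real_le) auto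
    from eventually_happens'[OF trivial_limit_at_top_linorder this]
    obtain c where c: "cmod (P $ i $ i + of_real c) \<le> a + \<epsilon> + c" for i
      by blast
    define \<rho> where "\<rho> = a + \<epsilon> + c"
    have diag: "diagonal (c *\<^sub>R mat 1 + P)"
      using P by (simp add: diagonal_def mat_def)
    have "norm2 (c *\<^sub>R mat 1 + P) \<le> \<rho>"
      using c by (intro norm2_diagonal_le[OF diag])
        (simp add: \<rho>_def mat_def scaleR_complex add.commute)
    note pow = norm2_mat_pow_triangular_le[OF diag Q this]
    have "(\<lambda>m. \<Sum>k<CARD('n). real (m choose k) * \<rho> ^ (m - k) / fact m * norm2 Q ^ k)
        sums (\<Sum>k<CARD('n). exp \<rho> / fact k * norm2 Q ^ k)"
      by (intro sums_sum sums_mult2 binomial_exp_sums)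
    then have "(\<lambda>m. (\<Sum>k<CARD('n). real (m choose k) * \<rho> ^ (m - k) * norm2 Q ^ k) / fact m)
        sums (exp \<rho> * S)"
      by (simp add: S_def sum_distrib_left sum_divide_distrib)
    from norm2_mat_exp_le[OF pow this]
    have "norm2 (mat_exp (c *\<^sub>R mat 1 + (P + Q))) \<le> exp \<rho> * S"
      by (simp add: add.assoc)
    \<comment> \<open>Since \<open>\<rho> = a + \<epsilon> + c\<close>, the factor
      \<open>exp c\<close> occurs on both sides and the shift cancels.\<close>
    then have "exp c * norm2 (mat_exp (P + Q)) \<le> exp c * (exp (a + \<epsilon>) * S)"
      by (simp add: mat_exp_add_scalar norm2_scaleR \<rho>_def exp_add mult_ac)
    then show ?thesis by simp
  qed
  then have "\<forall>\<^sub>F \<epsilon> in at_right 0. norm2 (mat_exp (P + Q)) \<le> exp (a + \<epsilon>) * S"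
    by (simp add: eventually_at_right_less eventually_mono[OF eventually_at_right_less])
  moreover have "((\<lambda>\<epsilon>. exp (a + \<epsilon>) * S) \<longlongrightarrow> exp (a + 0) * S) (at_right 0)"
    by (intro tendsto_intros)
  ultimately show ?thesis
    using tendsto_lowerbound[of "\<lambda>\<epsilon>. exp (a + \<epsilon>) * S" "exp a * S" "at_right 0"]
    by (simp add: S_def)
qed

section \<open>The spectrum of a triangular matrix\<close>

lemma spectrum_unitary_conj:
  fixes M :: "complex^'n^'n"
  assumes "unitary U"
  shows "spectrum (U ** M ** adj U) = spectrum M"
proof -
  have sub: "spectrum M \<subseteq> spectrum (U ** M ** adj U)" if "unitary U" for U M :: "complex^'n^'n"
  proof
    fix z assume "z \<in> spectrum M"
    then obtain v where v: "v \<noteq> 0" "M *v v = z *s v" by (auto simp: spectrum_def)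
    have "U ** M ** adj U *v (U *v v) = U ** M ** (adj U ** U) *v v"
      by (simp add: matrix_vector_mul_assoc matrix_mul_assoc)
    also have "\<dots> = U *v (z *s v)"
      using that v(2) by (simp add: unitary_def matrix_vector_mul_assoc[symmetric])
    also have "\<dots> = z *s (U *v v)"
      by (rule vec.scale)
    finally have "U ** M ** adj U *v (U *v v) = z *s (U *v v)" .
    moreover have "U *v v \<noteq> 0"
      using v(1) that norm_unitary_mult_vec[of U v] by (auto simp: unitary_def)
    ultimately show "z \<in> spectrum (U ** M ** adj U)" by (auto simp: spectrum_def)
  qed
  \<comment> \<open>Conjugating back by \<open>adj U\<close> reduces the reverse inclusion to
    \<open>sub\<close>.\<close>
  have "adj U ** (U ** M ** adj U) ** adj (adj U) = (adj U ** U) ** M ** (adj U ** U)"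
    by (simp only: adj_adj matrix_mul_assoc)
  also have "\<dots> = M" using assms by (simp add: unitary_def)
  finally have "adj U ** (U ** M ** adj U) ** adj (adj U) = M" .
  moreover have "unitary (adj U)" using assms by (simp add: unitary_def adj_adj)
  ultimately have "spectrum (U ** M ** adj U) \<subseteq> spectrum M"
    using sub[of "adj U" "U ** M ** adj U"] by simp
  then show ?thesis using sub[OF assms, of M] by simp
qed

text \<open>The determinant form lets the spectrum of a triangular matrix be read off as the zeros
  of a product over the diagonal.\<close>

lemma mem_spectrum_iff_det: "z \<in> spectrum M \<longleftrightarrow> det (M - mat z) = 0"
proof -
  have "(M - mat z) *v v = M *v v - z *s v" for v
  proof -
    have "(mat z) *v v = z *s v"
      by (simp add: vec_eq_iff matrix_vector_mult_def mat_def if_distrib if_distribR mult_delta_left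
          cong: if_cong)
    then show ?thesis by (simp add: matrix_vector_mult_diff_rdistrib)
  qed
  then show ?thesis
    using invertible_det_nz[of "M - mat z"] matrix_left_invertible_ker[of "M - mat z"]
    by (auto simp: spectrum_def invertible_left_inverse)
qed

lemma spectrum_triangular:
  fixes D N :: "complex^'n::{finite,wellorder}^'n::{finite,wellorder}"
  assumes "diagonal D" and "strictly_upper_triangular N"
  shows "spectrum (D + N) = range (\<lambda>i. D $ i $ i)"
proof -
  have "det (D + N - mat z) = (\<Prod>i\<in>UNIV. D $ i $ i - z)" for z
    using assms by (subst det_upperdiagonal)
      (auto simp: diagonal_def strictly_upper_triangular_def mat_def)
  then show ?thesis by (auto simp: mem_spectrum_iff_det)
qed

lemma schur_decomposition_spectrum:
  "schur_decomposition A U D N \<Longrightarrow> spectrum A = range (\<lambda>i. D $ i $ i)"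
  by (auto simp: schur_decomposition_def spectrum_unitary_conj spectrum_triangular)

section \<open>The incomplete gamma function\<close>

text \<open>The integrand of Euler's integral is nonnegative, hence absolutely integrable on the
  half-line, and absolute integrability passes to the subset \<open>{r..}\<close>.\<close>

lemma inc_Gamma_integrable:
  fixes x r :: real
  assumes "0 < x" "0 \<le> r"
  shows "(\<lambda>t. exp (- t) * t powr (x - 1)) integrable_on {r..}"
proof -
  have "(\<lambda>t. t powr (x - 1) / exp t) integrable_on {0..}"
    using Gamma_integral_real[OF assms(1)] by (rule has_integral_integrable)
  then have "(\<lambda>t. t powr (x - 1) / exp t) absolutely_integrable_on {0..}"
    by (rule nonnegative_absolutely_integrable_1) auto
  then have "(\<lambda>t. t powr (x - 1) / exp t) absolutely_integrable_on {r..}"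
    by (rule set_integrable_subset) (use assms(2) in auto)
  then show ?thesis
    by (auto simp: exp_minus divide_inverse mult.commute dest: set_lebesgue_integral_eq_integral(1))
qed

section \<open>Bounding the matrix integrand for t at least 1\<close>

lemma norm2_powr_mat_le:
  fixes A U D N :: "complex^'n::{finite,wellorder}^'n::{finite,wellorder}"
  assumes "schur_decomposition A U D N" "1 \<le> t"
  shows "norm2 (powr_mat t (A - mat 1))
    \<le> t powr (spectral_abscissa A - 1) * (\<Sum>k<CARD('n). (ln t * norm2 N) ^ k / fact k)"
proof -
  define s where "s = ln t"
  have s: "0 \<le> s" using assms(2) by (simp add: s_def)
  have U: "unitary U" and D: "diagonal D" and N: "strictly_upper_triangular N"
    and A: "A = U ** (D + N) ** adj U"
    using assms(1) by (auto simp: schur_decomposition_def)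
  define P where "P = s *\<^sub>R (D - mat 1)"
  have "A - mat 1 = U ** (D + N - mat 1) ** adj U"
    using U by (simp add: A unitary_def matrix_diff_ldistrib matrix_diff_rdistrib)
  moreover have "P + s *\<^sub>R N = s *\<^sub>R (D + N - mat 1)"
    by (simp add: P_def algebra_simps)
  ultimately have "s *\<^sub>R (A - mat 1) = U ** (P + s *\<^sub>R N) ** adj U"
    by (simp only: scalar_matrix_assoc[symmetric] matrix_scalar_ac)
  then have "norm2 (powr_mat t (A - mat 1)) \<le> norm2 (mat_exp (P + s *\<^sub>R N))"
    using U by (simp add: powr_mat_def s_def[symmetric] mat_exp_unitary_conj norm2_unitary_conj_le)
  also have "\<dots> \<le> exp (s * (spectral_abscissa A - 1)) * (\<Sum>k<CARD('n). norm2 (s *\<^sub>R N) ^ k / fact k)"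
  proof (rule norm2_mat_exp_triangular_le)
    show "diagonal P" using D by (simp add: diagonal_def P_def mat_def)
    show "strictly_upper_triangular (s *\<^sub>R N)"
      using N by (simp add: strictly_upper_triangular_def)
    show "Re (P $ i $ i) \<le> s * (spectral_abscissa A - 1)" for i
    proof -
      have "Re (D $ i $ i) \<le> spectral_abscissa A"
        unfolding spectral_abscissa_def schur_decomposition_spectrum[OF assms(1)]
        by (rule Max_ge) auto
      \<comment> \<open>Here \<open>t \<ge> 1\<close> matters: \<open>s = ln t\<close> is
        nonnegative, so scaling by it preserves the inequality.\<close>
      then show ?thesis using s by (simp add: P_def mat_def mult_left_mono)
    qed
  qed
  also have "exp (s * (spectral_abscissa A - 1)) = t powr (spectral_abscissa A - 1)"
    using assms(2) by (simp add: powr_def s_def mult.commute)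
  finally show ?thesis
    using s by (simp add: norm2_scaleR s_def)
qed

text \<open>Write ln t = ln (t/2) + ln 2 \<le> t/2 - 1 + ln 2 and use ln 2 < 1.\<close>

lemma ln_le_half: "0 < t \<Longrightarrow> ln t \<le> t / 2" for t :: real
  using ln_le_minus_one[of "t / 2"] ln_2_less_1 by (simp add: ln_div)

lemma ln_mult_norm2_le:
  fixes N :: "complex^'n::{finite,wellorder}^'n::{finite,wellorder}"
  assumes "strictly_upper_triangular N" "1 \<le> t"
  shows "ln t * norm2 N \<le> norm2 (N - mat 1) * t"
proof -
  have N: "norm2 N \<le> norm2 (N - mat 1) + 1"
    using norm2_add[of "N - mat 1" "mat 1"] norm2_mat_1_le[where 'a = 'n] by simp
  \<comment> \<open>This only names some index; the diagonal entry of \<open>N - mat 1\<close> there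
    is -1.\<close>
  obtain i :: 'n where True by simp
  have x: "1 \<le> norm2 (N - mat 1)"
    using norm_entry_le_norm2[of "N - mat 1" i i] assms(1)
    by (simp add: strictly_upper_triangular_def mat_def)
  have "ln t * norm2 N \<le> t / 2 * (norm2 (N - mat 1) + 1)"
    using assms(2) N ln_le_half[of t] by (intro mult_mono) (auto simp: norm2_nonneg)
  also have "\<dots> \<le> t / 2 * (2 * norm2 (N - mat 1))"
    using assms(2) x by (intro mult_left_mono) auto
  finally show ?thesis by (simp add: mult.commute)
qed

theorem theorem2:
  fixes A U D N :: "complex^'n::{finite,wellorder}^'n::{finite,wellorder}" and r :: real
  assumes "\<forall>z\<in>spectrum A. Re z > 0"
    and "schur_decomposition A U D N"
    and "r \<ge> 1"
  shows "norm2 (mat_inc_Gamma A r)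
    \<le> (\<Sum>k = 0..CARD('n) - 1. norm2 (N - mat 1) ^ k / fact k * inc_Gamma (spectral_abscissa A + real k) r)"
proof -
  define \<alpha> where "\<alpha> = spectral_abscissa A"
  define x where "x = norm2 (N - mat 1)"
  define F where "F t = exp (- t) *\<^sub>R powr_mat t (A - mat 1)" for t
  define g where "g t = (\<Sum>k<CARD('n). x ^ k / fact k * (exp (- t) * t powr (\<alpha> + real k - 1)))" for t
  have "0 \<le> x" by (simp add: x_def norm2_nonneg)
  \<comment> \<open>The maximum is attained, so \<open>\<alpha>\<close> is positive and all the
    scalar integrals in \<open>g\<close> converge.\<close>
  have "\<alpha> \<in> Re ` spectrum A"
    unfolding \<alpha>_def spectral_abscissa_def schur_decomposition_spectrum[OF assms(2)]
    by (rule Max_in) auto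
  then have "0 < \<alpha>" using assms(1) by auto
  have g: "(g has_integral (\<Sum>k<CARD('n). x ^ k / fact k * inc_Gamma (\<alpha> + real k) r)) {r..}"
    unfolding g_def inc_Gamma_def using assms(3) \<open>0 < \<alpha>\<close>
    by (intro has_integral_sum has_integral_mult_right integrable_integral inc_Gamma_integrable) auto
  have F: "norm2 (F t) \<le> g t" if "t \<in> {r..}" for t
  proof -
    have t: "1 \<le> t" using that assms(3) by simp
    have N: "strictly_upper_triangular N" using assms(2) by (simp add: schur_decomposition_def)
    have "norm2 (F t) = exp (- t) * norm2 (powr_mat t (A - mat 1))"
      by (simp add: F_def norm2_scaleR)
    also have "\<dots> \<le> exp (- t) * (t powr (\<alpha> - 1) * (\<Sum>k<CARD('n). (ln t * norm2 N) ^ k / fact k))"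
      unfolding \<alpha>_def by (intro mult_left_mono norm2_powr_mat_le[OF assms(2) t]) simp
    also have "\<dots> \<le> exp (- t) * (t powr (\<alpha> - 1) * (\<Sum>k<CARD('n). (x * t) ^ k / fact k))"
      using t ln_mult_norm2_le[OF N t]
      by (intro mult_left_mono sum_mono divide_right_mono power_mono) (auto simp: x_def norm2_nonneg)
    also have "\<dots> = g t"
    proof -
      have "t powr (\<alpha> + real k - 1) = t powr (\<alpha> - 1) * t ^ k" for k
      proof -
        have "\<alpha> + real k - 1 = (\<alpha> - 1) + real k" by simp
        then show ?thesis using t by (simp only: powr_add) (simp add: powr_realpow)
      qed
      then show ?thesis
        by (simp add: g_def sum_distrib_left power_mult_distrib mult_ac)
    qed
    finally show ?thesis .
  qed
  have "norm2 (integral {r..} F) \<le> integral {r..} g"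
  proof (cases "F integrable_on {r..}")
    case True
    show ?thesis
    \<comment> \<open>Testing on a fixed vector replaces the matrix integral by a Euclidean vector
      integral, where the standard norm bound applies.\<close>
    proof (rule norm2_leI)
      fix v
      have Fv: "((\<lambda>t. F t *v v) has_integral (integral {r..} F *v v)) {r..}"
        using has_integral_linear[OF integrable_integral[OF True] bounded_linear_mult_vec]
        by (simp add: o_def)
      have gv: "((\<lambda>t. g t * norm v) has_integral (integral {r..} g * norm v)) {r..}"
        using g by (intro has_integral_mult_left) (simp add: has_integral_iff)
      have "norm (integral {r..} (\<lambda>t. F t *v v)) \<le> integral {r..} (\<lambda>t. g t * norm v)"
        by (rule integral_norm_bound_integral)
           (use Fv gv in \<open>auto intro!: order_trans[OF norm_mult_vec_le] mult_right_mono F\<close>)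
      then show "norm (integral {r..} F *v v) \<le> integral {r..} g * norm v"
        using Fv gv by (simp add: integral_unique)
    qed
  next
    \<comment> \<open>A non-integrable function has integral 0 by convention, so it suffices that
      the integral of \<open>g\<close> is nonnegative.\<close>
    case False
    moreover have "0 \<le> integral {r..} g"
      using g F norm2_nonneg by (intro integral_nonneg) (auto intro: order_trans)
    ultimately show ?thesis by (simp add: not_integrable_integral)
  qed
  then have "norm2 (mat_inc_Gamma A r) \<le> (\<Sum>k<CARD('n). x ^ k / fact k * inc_Gamma (\<alpha> + real k) r)"
    using integral_unique[OF g] by (simp add: mat_inc_Gamma_def F_def[abs_def])
  \<comment> \<open>The natural subtraction is harmless because the index type is nonempty.\<close>
  moreover have "{..<CARD('n)} = {0..CARD('n) - 1}"
    using zero_less_card_finite[where 'a = 'n] by (auto simp del: zero_less_card_finite)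
  ultimately show ?thesis
    by (simp add: x_def \<alpha>_def)
qed

end
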